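(* Let $d\ge3$ be an integer. Then $\mathcal S^{(0)}_d=\mathcal R^{(0)}_d$ and $\mathcal S^{(1)}_d=-\mathcal R^{(1)}_d$ (as operators on $C^\infty(\mathbb S^{d-1})$).
   Context: $\mathbb S^{d-1}=\{x\in\mathbb R^d:\|x\|=1\}$. For $j\in\mathbb N_0$ and $f\in C^\infty(\mathbb S^{d-1})$ the generalized Funk--Radon transform is $\mathcal S^{(j)}_d f(\xi)=\int_{\mathbb S^{d-1}}\delta^{(j)}(\xi^\top\eta)f(\eta)\,d\eta$, where $\delta^{(j)}$ is the $j$-th derivative of the Dirac delta. This means precisely $$\mathcal S^{(j)}_d f(\xi)=(-1)^j\left(\frac{d}{dt}\right)^j\left[(1-t^2)^{-1/2}\int_{\{\eta\in\mathbb S^{d-1}:\,\xi^\top\eta=t\}}f(\eta)\,d\lambda(\eta)\right]_{t=0},\quad\xi\in\mathbb S^{d-1},$$ with $d\lambda$ the standard $(d-2)$-dimensional surface measure. The integro-differential transform $\mathcal R^{(j)}_d=\mathcal R^{(j)}_{d,0}$ is the case $\vartheta=0$ of $$\mathcal R^{(j)}_{d,\vartheta}f(\xi)=\int_{\{\omega\in\mathbb S^{d-1}:\,\xi^\top\omega=0\}}\left(\frac{\partial}{\partial\vartheta}\right)^jf(\xi\sin\vartheta+\omega\cos\vartheta)\,d\omega,\qquad\xi\in\mathbb S^{d-1},$$ where $d\omega$ is the $(d-2)$-dimensional surface measure. *)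

theory Defs
  imports "HOL-Analysis.Analysis"
begin

text \<open>
  Surface measure is rendered as the Hausdorff measure, with the factor
  \<open>unit_ball_vol k / 2 ^ k\<close> under which it agrees with Lebesgue measure on \<open>k\<close>-dimensional
  subspaces, and with the Riemannian volume on \<open>k\<close>-dimensional submanifolds.
  Empty covering sets are given weight 0 separately because \<open>0 ^ 0 = 1\<close>; boundedness is required
  because \<open>diameter\<close> is unspecified on unbounded sets.
\<close>

definition hausdorff_premeasure :: "nat \<Rightarrow> real \<Rightarrow> 'a::metric_space set \<Rightarrow> ennreal" where
  "hausdorff_premeasure k \<delta> A =
     (INF C \<in> {C :: nat \<Rightarrow> 'a set. A \<subseteq> (\<Union>i. C i) \<and> (\<forall>i. bounded (C i) \<and> diameter (C i) \<le> \<delta>)}.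
        \<Sum>i. if C i = {} then 0
            else ennreal (unit_ball_vol (real k) * (diameter (C i) / 2) ^ k))"

definition hausdorff_outer_measure :: "nat \<Rightarrow> 'a::metric_space set \<Rightarrow> ennreal" where
  "hausdorff_outer_measure k A = (SUP \<delta> \<in> {0<..}. hausdorff_premeasure k \<delta> A)"

text \<open>
  The outer measure is additive on sets at positive distance, so by Caratheodory's criterion it is
  countably additive on the Borel sets, and \<open>emeasure\<close> of the following measure agrees with it there.
\<close>

definition hausdorff_measure :: "nat \<Rightarrow> 'a::metric_space measure" where
  "hausdorff_measure k = measure_of UNIV (sets borel) (hausdorff_outer_measure k)"

text \<open>Intended for open \<open>U\<close>: all iterated directional derivatives up to order \<open>k\<close> exist and are
  continuous.\<close>

primrec C_k_on :: "nat \<Rightarrow> ('a::euclidean_space \<Rightarrow> 'b::real_normed_vector) \<Rightarrow> 'a set \<Rightarrow> bool" where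
  "C_k_on 0 f U \<longleftrightarrow> continuous_on U f"
| "C_k_on (Suc k) f U \<longleftrightarrow>
     f differentiable_on U \<and> (\<forall>v. C_k_on k (\<lambda>x. frechet_derivative f (at x) v) U)"

text \<open>Smoothness on an arbitrary subset such as an embedded submanifold: locally \<open>f\<close> is the
  restriction of a smooth function on an open set. Values of \<open>f\<close> outside \<open>S\<close> are irrelevant.\<close>

definition smooth_on :: "'a::euclidean_space set \<Rightarrow> ('a \<Rightarrow> 'b::real_normed_vector) \<Rightarrow> bool" where
  "smooth_on S f \<longleftrightarrow>
     (\<forall>x\<in>S. \<exists>U F. open U \<and> x \<in> U \<and> (\<forall>k. C_k_on k F U) \<and> (\<forall>y \<in> S \<inter> U. F y = f y))"

definition nth_vector_derivative :: "nat \<Rightarrow> (real \<Rightarrow> 'b::real_normed_vector) \<Rightarrow> real \<Rightarrow> 'b" where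
  "nth_vector_derivative j g = ((\<lambda>h t. vector_derivative h (at t)) ^^ j) g"

definition sphere_slice :: "(real ^ 'n) \<Rightarrow> real \<Rightarrow> (real ^ 'n) set" where
  "sphere_slice \<xi> t = {\<eta> \<in> sphere 0 1. \<xi> \<bullet> \<eta> = t}"

text \<open>\<open>generalized_funk_radon j\<close> is \<open>S\<^sub>d\<^sup>(\<^sup>j\<^sup>)\<close> for \<open>d = CARD('n)\<close>. The functions
  live on the whole space, but only their values on the unit sphere matter.\<close>

definition generalized_funk_radon ::
    "nat \<Rightarrow> (real ^ 'n \<Rightarrow> 'b::{banach, second_countable_topology}) \<Rightarrow> real ^ 'n \<Rightarrow> 'b" where
  "generalized_funk_radon j f \<xi> =
     (-1) ^ j *\<^sub>R nth_vector_derivative j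
       (\<lambda>t. (1 - t\<^sup>2) powr (-1/2) *\<^sub>R
            (LINT \<eta>:sphere_slice \<xi> t|hausdorff_measure (CARD('n) - 2). f \<eta>)) 0"

definition integro_differential_at ::
    "nat \<Rightarrow> real \<Rightarrow> (real ^ 'n \<Rightarrow> 'b::{banach, second_countable_topology}) \<Rightarrow> real ^ 'n \<Rightarrow> 'b" where
  "integro_differential_at j \<theta> f \<xi> =
     (LINT \<omega>:sphere_slice \<xi> 0|hausdorff_measure (CARD('n) - 2).
        nth_vector_derivative j (\<lambda>\<tau>. f (sin \<tau> *\<^sub>R \<xi> + cos \<tau> *\<^sub>R \<omega>)) \<theta>)"

definition integro_differential ::
    "nat \<Rightarrow> (real ^ 'n \<Rightarrow> 'b::{banach, second_countable_topology}) \<Rightarrow> real ^ 'n \<Rightarrow> 'b" where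
  "integro_differential j = integro_differential_at j 0"

end

theory Submission
  imports Defs
begin

text \<open>
  Write \<open>k = d - 2\<close>. For \<open>\<bar>t\<bar> < 1\<close> the slice of the sphere at height \<open>t\<close> is the image of the equator
  \<open>sphere_slice \<xi> 0\<close> under the similarity \<open>\<omega> \<mapsto> t *\<^sub>R \<xi> + sqrt (1 - t\<^sup>2) *\<^sub>R \<omega>\<close>. Hausdorff measure scales
  by the \<open>k\<close>-th power of the ratio (\<open>integral_hausdorff_measure_affine\<close>), hence the function
  differentiated in the generalized Funk--Radon transform is
  \<open>(1 - t\<^sup>2) powr (-1/2) * sqrt (1 - t\<^sup>2) ^ k\<close> times the integral of
  \<open>f (t *\<^sub>R \<xi> + sqrt (1 - t\<^sup>2) *\<^sub>R \<omega>)\<close> over the equator. At \<open>t = 0\<close> this is the integral of \<open>f\<close>, which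
  settles order 0.

  The factor in front has value 1 and derivative 0 at \<open>t = 0\<close>, so for order 1 only the integral has
  to be differentiated. The curves \<open>t *\<^sub>R \<xi> + sqrt (1 - t\<^sup>2) *\<^sub>R \<omega>\<close> and
  \<open>sin \<tau> *\<^sub>R \<xi> + cos \<tau> *\<^sub>R \<omega>\<close> have the same position and velocity at 0, so the integrands of
  both transforms have the same derivative there. Differentiation under the integral is dominated
  convergence (\<open>has_vector_derivative_set_integral\<close>). The bound on the difference quotients is a
  Lipschitz constant of \<open>f\<close> on the compact sphere (\<open>smooth_on_compact_imp_lipschitz\<close>), and
  constants are integrable because the equator has finite Hausdorff measure
  (\<open>emeasure_hausdorff_measure_unit_sphere_finite\<close>).
\<close>

section \<open>Hausdorff measure under similarities\<close>

text \<open>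
  A measure built from a set function that fails to be countably additive is the zero measure.
  The arguments below cover that case as well, so countable additivity of the outer measure on the
  Borel sets (Caratheodory's criterion) is never needed.
\<close>

lemma emeasure_hausdorff_measure:
  fixes A :: "'a::metric_space set"
  shows "emeasure (hausdorff_measure k) A =
     (if A \<in> sets borel \<and> measure_space UNIV (sets borel)
           (hausdorff_outer_measure k :: 'a::metric_space set \<Rightarrow> ennreal)
      then hausdorff_outer_measure k A else 0)"
  using sets.sigma_sets_eq[of "borel :: 'a measure"]
  by (simp add: hausdorff_measure_def emeasure_measure_of_conv)

lemma emeasure_hausdorff_measure_le: "emeasure (hausdorff_measure k) A \<le> hausdorff_outer_measure k A"
  by (simp add: emeasure_hausdorff_measure)

lemma sets_hausdorff_measure [simp, measurable_cong]:
  "sets (hausdorff_measure k :: 'a::metric_space measure) = sets borel"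
  using sets.sigma_sets_eq[of "borel :: 'a measure"]
  by (simp add: hausdorff_measure_def sets_measure_of_conv)

lemma space_hausdorff_measure [simp]: "space (hausdorff_measure k) = UNIV"
  by (simp add: hausdorff_measure_def space_measure_of_conv)

lemma hausdorff_premeasure_le_cover:
  assumes "A \<subseteq> (\<Union>i. C i)" "\<And>i. bounded (C i)" "\<And>i. diameter (C i) \<le> \<delta>"
  shows "hausdorff_premeasure k \<delta> A \<le>
    (\<Sum>i. if C i = {} then 0 else ennreal (unit_ball_vol (real k) * (diameter (C i) / 2) ^ k))"
  unfolding hausdorff_premeasure_def by (rule INF_lower) (use assms in auto)

lemma diameter_affine_image_le:
  fixes S :: "'a::real_normed_vector set"
  assumes "c > 0" "bounded S"
  shows "diameter ((\<lambda>x. a + c *\<^sub>R x) ` S) \<le> c * diameter S"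
proof (rule diameter_le)
  show "(\<lambda>x. a + c *\<^sub>R x) ` S \<noteq> {} \<or> 0 \<le> c * diameter S"
    using assms diameter_ge_0[of S] by auto
  fix x y assume "x \<in> (\<lambda>x. a + c *\<^sub>R x) ` S" "y \<in> (\<lambda>x. a + c *\<^sub>R x) ` S"
  then obtain u v where uv: "u \<in> S" "v \<in> S" "x = a + c *\<^sub>R u" "y = a + c *\<^sub>R v" by auto
  have "norm (x - y) = c * dist u v"
    using assms(1) uv by (simp add: dist_norm flip: scaleR_diff_right)
  also have "\<dots> \<le> c * diameter S"
    using uv assms diameter_bounded_bound[of S u v] by simp
  finally show "norm (x - y) \<le> c * diameter S" .
qed

lemma ennreal_mult_inverse_cancel:
  assumes "0 < r"
  shows "ennreal r * (ennreal (inverse r) * x) = x" "ennreal (inverse r) * (ennreal r * x) = x"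
proof -
  have 1: "ennreal r * ennreal (inverse r) = 1"
    using assms by (subst ennreal_mult[symmetric]) auto
  show "ennreal r * (ennreal (inverse r) * x) = x"
    unfolding mult.assoc[symmetric] 1 by simp
  show "ennreal (inverse r) * (ennreal r * x) = x"
    unfolding mult.assoc[symmetric] mult.commute[of "ennreal (inverse r)"] 1 by simp
qed

lemma hausdorff_premeasure_affine_image_le:
  fixes A :: "'a::real_normed_vector set"
  assumes c: "c > 0"
  shows "hausdorff_premeasure k (c * \<delta>) ((\<lambda>x. a + c *\<^sub>R x) ` A)
           \<le> ennreal (c ^ k) * hausdorff_premeasure k \<delta> A"
proof -
  let ?\<phi> = "\<lambda>x. a + c *\<^sub>R x"
  let ?w = "\<lambda>C. if C = {} then 0 else ennreal (unit_ball_vol (real k) * (diameter C / 2) ^ k)"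
  have *: "hausdorff_premeasure k (c * \<delta>) (?\<phi> ` A) \<le> ennreal (c ^ k) * (\<Sum>i. ?w (C i))"
    if C: "A \<subseteq> (\<Union>i. C i)" "\<And>i. bounded (C i)" "\<And>i. diameter (C i) \<le> \<delta>"
    for C :: "nat \<Rightarrow> 'a set"
  proof -
    have bd: "bounded (?\<phi> ` C i)" for i
      using bounded_translation[OF bounded_scaling[OF C(2)[of i]], of a c]
      by (simp add: image_image)
    have diam: "diameter (?\<phi> ` C i) \<le> c * diameter (C i)" for i
      by (rule diameter_affine_image_le[OF c C(2)])
    have "hausdorff_premeasure k (c * \<delta>) (?\<phi> ` A) \<le> (\<Sum>i. ?w (?\<phi> ` C i))"
    proof (rule hausdorff_premeasure_le_cover)
      show "diameter (?\<phi> ` C i) \<le> c * \<delta>" for i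
        using diam[of i] mult_left_mono[OF C(3)[of i], of c] c by linarith
    qed (use C(1) bd in blast)+
    also have "\<dots> \<le> (\<Sum>i. ennreal (c ^ k) * ?w (C i))"
    proof (rule suminf_le)
      fix i
      have "(diameter (?\<phi> ` C i) / 2) ^ k \<le> (c * (diameter (C i) / 2)) ^ k"
        using diam[of i] diameter_ge_0[OF bd[of i]] by (intro power_mono) auto
      then have "(diameter (?\<phi> ` C i) / 2) ^ k \<le> c ^ k * (diameter (C i) / 2) ^ k"
        by (simp only: power_mult_distrib)
      then have "unit_ball_vol (real k) * (diameter (?\<phi> ` C i) / 2) ^ k
          \<le> c ^ k * (unit_ball_vol (real k) * (diameter (C i) / 2) ^ k)"
        using mult_left_mono[of _ _ "unit_ball_vol (real k)"]
        by (simp add: mult.left_commute)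
      then show "?w (?\<phi> ` C i) \<le> ennreal (c ^ k) * ?w (C i)"
        using c diameter_ge_0[OF C(2)[of i]] by (auto simp: ennreal_leI simp flip: ennreal_mult)
    qed auto
    finally show ?thesis by simp
  qed
  have "ennreal (inverse (c ^ k)) * hausdorff_premeasure k (c * \<delta>) (?\<phi> ` A)
          \<le> hausdorff_premeasure k \<delta> A"
    unfolding hausdorff_premeasure_def[of k \<delta>]
  proof (rule INF_greatest, clarify)
    fix C :: "nat \<Rightarrow> 'a set"
    assume "A \<subseteq> (\<Union>i. C i)" "\<forall>i. bounded (C i) \<and> diameter (C i) \<le> \<delta>"
    then have "ennreal (inverse (c ^ k)) * hausdorff_premeasure k (c * \<delta>) (?\<phi> ` A)
        \<le> ennreal (inverse (c ^ k)) * (ennreal (c ^ k) * (\<Sum>i. ?w (C i)))"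
      by (intro mult_left_mono *) auto
    also have "\<dots> = (\<Sum>i. ?w (C i))"
      using c by (intro ennreal_mult_inverse_cancel) simp
    finally show "ennreal (inverse (c ^ k)) * hausdorff_premeasure k (c * \<delta>) (?\<phi> ` A)
        \<le> (\<Sum>i. ?w (C i))" .
  qed
  then have "ennreal (c ^ k) * (ennreal (inverse (c ^ k)) * hausdorff_premeasure k (c * \<delta>) (?\<phi> ` A))
          \<le> ennreal (c ^ k) * hausdorff_premeasure k \<delta> A"
    by (rule mult_left_mono) simp
  then show ?thesis
    using c by (simp only: ennreal_mult_inverse_cancel zero_less_power)
qed

lemma hausdorff_outer_measure_affine_image_le:
  fixes A :: "'a::real_normed_vector set"
  assumes c: "c > 0"
  shows "hausdorff_outer_measure k ((\<lambda>x. a + c *\<^sub>R x) ` A)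
           \<le> ennreal (c ^ k) * hausdorff_outer_measure k A"
  unfolding hausdorff_outer_measure_def[of k "(\<lambda>x. a + c *\<^sub>R x) ` A"]
proof (rule SUP_least)
  fix \<delta> :: real assume "\<delta> \<in> {0<..}"
  then have \<delta>: "\<delta> / c > 0" using c by simp
  have "hausdorff_premeasure k \<delta> ((\<lambda>x. a + c *\<^sub>R x) ` A)
      \<le> ennreal (c ^ k) * hausdorff_premeasure k (\<delta> / c) A"
    using hausdorff_premeasure_affine_image_le[OF c, of k "\<delta> / c" a A] c by simp
  also have "\<dots> \<le> ennreal (c ^ k) * hausdorff_outer_measure k A"
    unfolding hausdorff_outer_measure_def
    by (intro mult_left_mono SUP_upper) (use \<delta> in auto)
  finally show "hausdorff_premeasure k \<delta> ((\<lambda>x. a + c *\<^sub>R x) ` A)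
      \<le> ennreal (c ^ k) * hausdorff_outer_measure k A" .
qed

text \<open>The inequality missing for equality is the upper bound for the inverse similarity.\<close>

lemma hausdorff_outer_measure_affine_image:
  fixes A :: "'a::real_normed_vector set"
  assumes c: "c > 0"
  shows "hausdorff_outer_measure k ((\<lambda>x. a + c *\<^sub>R x) ` A)
           = ennreal (c ^ k) * hausdorff_outer_measure k A"
proof (rule antisym[OF hausdorff_outer_measure_affine_image_le[OF c]])
  let ?B = "(\<lambda>x. a + c *\<^sub>R x) ` A"
  have A: "(\<lambda>x. - (inverse c *\<^sub>R a) + inverse c *\<^sub>R x) ` ?B = A"
    using c by (auto simp: image_image scaleR_right_distrib)
  have "hausdorff_outer_measure k A \<le> ennreal (inverse c ^ k) * hausdorff_outer_measure k ?B"
    using hausdorff_outer_measure_affine_image_le[of "inverse c" k "- (inverse c *\<^sub>R a)" ?B] c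
    unfolding A by simp
  then have "ennreal (c ^ k) * hausdorff_outer_measure k A
      \<le> ennreal (c ^ k) * (ennreal (inverse c ^ k) * hausdorff_outer_measure k ?B)"
    by (rule mult_left_mono) simp
  then show "ennreal (c ^ k) * hausdorff_outer_measure k A \<le> hausdorff_outer_measure k ?B"
    using c by (simp only: power_inverse ennreal_mult_inverse_cancel zero_less_power)
qed

lemma distr_hausdorff_measure_affine:
  fixes a :: "'a::euclidean_space"
  assumes c: "c > 0"
  shows "distr (hausdorff_measure k) borel (\<lambda>x. a + c *\<^sub>R x)
           = density (hausdorff_measure k) (\<lambda>_. ennreal (inverse (c ^ k)))"
proof (rule measure_eqI)
  let ?\<phi> = "\<lambda>x. a + c *\<^sub>R x"
  fix B assume "B \<in> sets (distr (hausdorff_measure k) borel ?\<phi>)"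
  then have B: "B \<in> sets borel" by simp
  have pre: "?\<phi> -` B \<in> sets borel"
    using measurable_sets[of ?\<phi> borel borel B] B by simp
  have "B = ?\<phi> ` (?\<phi> -` B)"
  proof safe
    fix x assume "x \<in> B"
    then show "x \<in> ?\<phi> ` (?\<phi> -` B)"
      using c by (intro image_eqI[of _ _ "inverse c *\<^sub>R (x - a)"]) auto
  qed
  then have "hausdorff_outer_measure k B = ennreal (c ^ k) * hausdorff_outer_measure k (?\<phi> -` B)"
    by (metis hausdorff_outer_measure_affine_image[OF c])
  then have "hausdorff_outer_measure k (?\<phi> -` B) = ennreal (inverse (c ^ k)) * hausdorff_outer_measure k B"
    using c by (simp only: ennreal_mult_inverse_cancel zero_less_power)
  moreover have "emeasure (distr (hausdorff_measure k) borel ?\<phi>) B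
      = emeasure (hausdorff_measure k) (?\<phi> -` B)"
    using B by (subst emeasure_distr) auto
  ultimately show "emeasure (distr (hausdorff_measure k) borel ?\<phi>) B
      = emeasure (density (hausdorff_measure k) (\<lambda>_. ennreal (inverse (c ^ k)))) B"
    using B pre by (simp add: emeasure_density_const emeasure_hausdorff_measure)
qed simp

lemma integral_hausdorff_measure_affine:
  fixes g :: "'a::euclidean_space \<Rightarrow> 'b::{banach, second_countable_topology}"
  assumes c: "c > 0" and g: "g \<in> borel_measurable borel"
  shows "(LINT x|hausdorff_measure k. g x)
           = c ^ k *\<^sub>R (LINT x|hausdorff_measure k. g (a + c *\<^sub>R x))"
proof -
  have "(LINT x|hausdorff_measure k. g (a + c *\<^sub>R x))
      = (LINT x|distr (hausdorff_measure k) borel (\<lambda>x. a + c *\<^sub>R x). g x)"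
    using g by (intro integral_distr[symmetric]) auto
  also have "\<dots> = (LINT x|hausdorff_measure k. inverse (c ^ k) *\<^sub>R g x)"
    unfolding distr_hausdorff_measure_affine[OF c]
    using c g by (intro integral_density) auto
  finally show ?thesis using c by simp
qed

section \<open>Finiteness of the Hausdorff measure of a unit sphere\<close>

lemma hausdorff_premeasure_le_finite_cover:
  assumes J: "finite J" and cov: "A \<subseteq> (\<Union>j\<in>J. D j)"
    and bd: "\<And>j. j \<in> J \<Longrightarrow> bounded (D j)" and diam: "\<And>j. j \<in> J \<Longrightarrow> diameter (D j) \<le> r"
    and r: "0 \<le> r" "r \<le> \<delta>"
  shows "hausdorff_premeasure k \<delta> A
           \<le> ennreal (real (card J) * (unit_ball_vol (real k) * (r / 2) ^ k))"
proof -
  obtain e where e: "bij_betw e {..<card J} J"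
    using ex_bij_betw_nat_finite[OF J] by (auto simp: atLeast0LessThan)
  define C where "C = (\<lambda>i. if i < card J then D (e i) else {})"
  let ?w = "\<lambda>C. if C = {} then 0 else ennreal (unit_ball_vol (real k) * (diameter C / 2) ^ k)"
  have eJ: "e i \<in> J" if "i < card J" for i
    using e that by (auto simp: bij_betw_def)
  have "A \<subseteq> (\<Union>i<card J. D (e i))"
    using cov bij_betw_imp_surj_on[OF e] by (metis image_image)
  then have UC: "A \<subseteq> (\<Union>i. C i)" by (force simp: C_def)
  have C: "bounded (C i)" "diameter (C i) \<le> r" for i
    using bd diam eJ r by (auto simp: C_def)
  have "hausdorff_premeasure k \<delta> A \<le> (\<Sum>i. ?w (C i))"
    using C r(2) by (intro hausdorff_premeasure_le_cover[OF UC]) (auto intro: order_trans)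
  also have "\<dots> = (\<Sum>i<card J. ?w (C i))"
    by (rule suminf_finite) (auto simp: C_def)
  also have "\<dots> \<le> (\<Sum>i<card J. ennreal (unit_ball_vol (real k) * (r / 2) ^ k))"
  proof (rule sum_mono)
    fix i
    have "unit_ball_vol (real k) * (diameter (C i) / 2) ^ k \<le> unit_ball_vol (real k) * (r / 2) ^ k"
      using C[of i] diameter_ge_0[OF C(1)[of i]] by (intro mult_left_mono power_mono) auto
    then show "?w (C i) \<le> ennreal (unit_ball_vol (real k) * (r / 2) ^ k)"
      by (auto intro: ennreal_leI)
  qed
  also have "\<dots> = ennreal (real (card J) * (unit_ball_vol (real k) * (r / 2) ^ k))"
    using r by (simp add: ennreal_mult ennreal_of_nat_eq_real_of_nat)
  finally show ?thesis .
qed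

text \<open>
  The functions \<open>p i\<close> map \<open>A\<close> into the cube \<open>[-1, 1]\<^sup>k\<close> with \<open>k = card I\<close>, and the inverse of this
  map is Lipschitz. The grid of mesh \<open>1 / m\<close> cuts \<open>A\<close> into at most \<open>(2 * m + 1) ^ k\<close> pieces of
  diameter of order \<open>1 / m\<close>, so the weight of this cover stays bounded as \<open>m\<close> grows.
\<close>

lemma hausdorff_outer_measure_finite_if_coordinates:
  fixes A :: "'a::real_normed_vector set" and p :: "'i \<Rightarrow> 'a \<Rightarrow> real"
  assumes I: "finite I" and p1: "\<And>i x. i \<in> I \<Longrightarrow> x \<in> A \<Longrightarrow> \<bar>p i x\<bar> \<le> 1"
    and L: "0 \<le> L"
    and lip: "\<And>x y. x \<in> A \<Longrightarrow> y \<in> A \<Longrightarrow> dist x y \<le> L * (\<Sum>i\<in>I. \<bar>p i x - p i y\<bar>)"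
  shows "hausdorff_outer_measure (card I) A < \<infinity>"
proof -
  let ?k = "card I"
  have "hausdorff_outer_measure ?k A
      \<le> ennreal (unit_ball_vol (real ?k) * (3 * L * real ?k / 2) ^ ?k)"
    unfolding hausdorff_outer_measure_def
  proof (rule SUP_least)
    fix \<delta> :: real assume "\<delta> \<in> {0<..}"
    then have \<delta>: "\<delta> > 0" by simp
    obtain m :: nat where m': "L * real ?k / \<delta> < real m"
      using reals_Archimedean2 by blast
    moreover have "0 \<le> L * real ?k / \<delta>" using L \<delta> by simp
    ultimately have m: "m > 0" by linarith
    \<comment> \<open>The bound on the diameter of a piece: two points in the same grid cell differ by at most
      \<open>1 / m\<close> in each of the \<open>?k\<close> coordinates.\<close>
    define r where "r = L * real ?k / real m"
    have r: "0 \<le> r" "r \<le> \<delta>"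
      using L m m' \<delta> by (auto simp: r_def field_simps)
    define J where "J = Pi\<^sub>E I (\<lambda>_. {- int m..int m})"
    define D where "D = (\<lambda>g. {x \<in> A. \<forall>i\<in>I. \<lfloor>real m * p i x\<rfloor> = g i})"
    have cardJ: "card J = (2 * m + 1) ^ ?k"
      using I by (simp add: J_def card_PiE nat_add_distrib nat_mult_distrib)
    have D: "norm (x - y) \<le> r" if "x \<in> D g" "y \<in> D g" for g x y
    proof -
      have "\<bar>p i x - p i y\<bar> \<le> 1 / real m" if "i \<in> I" for i
      proof -
        have "\<lfloor>real m * p i x\<rfloor> = \<lfloor>real m * p i y\<rfloor>"
          using \<open>x \<in> D g\<close> \<open>y \<in> D g\<close> that by (simp add: D_def)
        then have "\<bar>real m * p i x - real m * p i y\<bar> \<le> 1" by linarith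
        then have "real m * \<bar>p i x - p i y\<bar> \<le> 1"
          by (simp add: abs_mult flip: right_diff_distrib)
        then show ?thesis using m by (simp add: field_simps)
      qed
      then have "(\<Sum>i\<in>I. \<bar>p i x - p i y\<bar>) \<le> real ?k * (1 / real m)"
        by (rule sum_bounded_above)
      then have "L * (\<Sum>i\<in>I. \<bar>p i x - p i y\<bar>) \<le> L * (real ?k * (1 / real m))"
        by (rule mult_left_mono) (fact L)
      moreover have "norm (x - y) \<le> L * (\<Sum>i\<in>I. \<bar>p i x - p i y\<bar>)"
        using lip[of x y] that by (simp add: D_def dist_norm)
      ultimately show ?thesis by (simp add: r_def)
    qed
    have "hausdorff_premeasure ?k \<delta> A
        \<le> ennreal (real (card J) * (unit_ball_vol (real ?k) * (r / 2) ^ ?k))"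
    proof (rule hausdorff_premeasure_le_finite_cover)
      show "finite J" using I by (simp add: J_def finite_PiE)
      show "A \<subseteq> (\<Union>j\<in>J. D j)"
      proof
        fix x assume x: "x \<in> A"
        define g where "g = (\<lambda>i\<in>I. \<lfloor>real m * p i x\<rfloor>)"
        have "- int m \<le> \<lfloor>real m * p i x\<rfloor> \<and> \<lfloor>real m * p i x\<rfloor> \<le> int m" if "i \<in> I" for i
        proof -
          have "\<bar>real m * p i x\<bar> \<le> real m"
            using mult_left_mono[OF p1[OF that x], of "real m"] by (simp add: abs_mult)
          then show ?thesis by linarith
        qed
        then have "g \<in> J" by (auto simp: g_def J_def)
        moreover have "x \<in> D g" using x by (simp add: D_def g_def)
        ultimately show "x \<in> (\<Union>j\<in>J. D j)" by blast
      qed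
      show "bounded (D g)" for g
      proof (cases "D g = {}")
        case False
        then obtain x where "x \<in> D g" by blast
        then show ?thesis
          using D unfolding bounded_def dist_norm by blast
      qed simp
      show "diameter (D g) \<le> r" for g
        using r(1) D by (intro diameter_le) auto
    qed (use r in auto)
    also have "\<dots> \<le> ennreal (unit_ball_vol (real ?k) * (3 * L * real ?k / 2) ^ ?k)"
    proof (rule ennreal_leI)
      have "real (card J) * (r / 2) ^ ?k = ((2 * real m + 1) * (r / 2)) ^ ?k"
        unfolding power_mult_distrib cardJ by (simp add: add.commute)
      also have "\<dots> \<le> (3 * L * real ?k / 2) ^ ?k"
      proof (rule power_mono)
        have "(2 * real m + 1) * (r / 2) \<le> (3 * real m) * (r / 2)"
          using m r by (intro mult_right_mono) auto
        also have "\<dots> = 3 * L * real ?k / 2" using m by (simp add: r_def)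
        finally show "(2 * real m + 1) * (r / 2) \<le> 3 * L * real ?k / 2" .
      qed (use r in auto)
      finally show "real (card J) * (unit_ball_vol (real ?k) * (r / 2) ^ ?k)
          \<le> unit_ball_vol (real ?k) * (3 * L * real ?k / 2) ^ ?k"
        using mult_left_mono[of _ _ "unit_ball_vol (real ?k)"] by (simp add: mult.left_commute)
    qed
    finally show "hausdorff_premeasure ?k \<delta> A
        \<le> ennreal (unit_ball_vol (real ?k) * (3 * L * real ?k / 2) ^ ?k)" .
  qed
  then show ?thesis by (simp add: le_less_trans)
qed

text \<open>
  In an orthonormal basis \<open>B\<close> of \<open>V\<close> every unit vector has a coordinate whose square is at least
  \<open>1 / m\<close>, where \<open>m = k + 1\<close> is the size of \<open>B\<close>. On the patch where this coordinate has a given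
  index and sign, the remaining \<open>k\<close> coordinates determine it in a Lipschitz way, because the sum of
  all squares is constant.
\<close>

lemma emeasure_hausdorff_measure_unit_sphere_finite:
  fixes V :: "'a::euclidean_space set"
  assumes V: "subspace V" and dim: "dim V = Suc k"
  shows "emeasure (hausdorff_measure k) (V \<inter> sphere 0 1) < \<infinity>"
proof -
  obtain B where B: "B \<subseteq> V" "pairwise orthogonal B" "\<And>b. b \<in> B \<Longrightarrow> norm b = 1"
      "independent B" "card B = Suc k" "span B = V"
    using orthonormal_basis_subspace[OF V] dim by metis
  have finB: "finite B" using B(5) card.infinite by fastforce
  define m where "m = real (Suc k)"
  have m: "m \<ge> 1" by (simp add: m_def)
  have expand: "(\<Sum>b\<in>B. (x \<bullet> b) *\<^sub>R b) = x" if "x \<in> V" for x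
    using orthonormal_basis_expand[OF B(2,3) _ finB] that B(6) by blast
  have sq: "(\<Sum>b\<in>B. (x \<bullet> b)\<^sup>2) = 1" if "x \<in> V \<inter> sphere 0 1" for x
  proof -
    have "1 = x \<bullet> x" using that by (simp add: dot_square_norm)
    also have "\<dots> = (\<Sum>b\<in>B. (x \<bullet> b) *\<^sub>R b) \<bullet> x" using expand[of x] that by simp
    also have "\<dots> = (\<Sum>b\<in>B. (x \<bullet> b)\<^sup>2)"
      unfolding inner_sum_left by (simp add: power2_eq_square inner_commute)
    finally show ?thesis by simp
  qed
  have le1: "\<bar>x \<bullet> b\<bar> \<le> 1" if "x \<in> V \<inter> sphere 0 1" "b \<in> B" for x b
    using Cauchy_Schwarz_ineq2[of x b] B(3)[OF that(2)] that(1) by simp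
  \<comment> \<open>Since \<open>\<bar>x \<bullet> b\<bar> \<le> 1\<close>, the bound on the square passes to the absolute value of the
    coordinate, whose sign is \<open>s\<close>.\<close>
  define P where "P = (\<lambda>(b, s). {x \<in> V \<inter> sphere 0 1. 1 / m \<le> s * (x \<bullet> b)})"
  have cover: "V \<inter> sphere 0 1 \<subseteq> (\<Union>q\<in>B \<times> {1, -1}. P q)"
  proof
    fix x assume x: "x \<in> V \<inter> sphere 0 1"
    have "\<exists>b\<in>B. 1 / m \<le> (x \<bullet> b)\<^sup>2"
    proof (rule ccontr)
      assume "\<not> ?thesis"
      then have "(\<Sum>b\<in>B. (x \<bullet> b)\<^sup>2) < (\<Sum>b\<in>B. 1 / m)"
        using B(5) finB by (intro sum_strict_mono) auto
      then show False using sq[OF x] B(5) m by (simp add: m_def)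
    qed
    then obtain b where b: "b \<in> B" "1 / m \<le> (x \<bullet> b)\<^sup>2" by blast
    have "(x \<bullet> b)\<^sup>2 \<le> \<bar>x \<bullet> b\<bar>"
      using le1[OF x b(1)] mult_left_mono[of "\<bar>x \<bullet> b\<bar>" 1 "\<bar>x \<bullet> b\<bar>"]
      by (simp add: power2_eq_square)
    with b(2) have "1 / m \<le> 1 * (x \<bullet> b) \<or> 1 / m \<le> (-1) * (x \<bullet> b)" by linarith
    then show "x \<in> (\<Union>q\<in>B \<times> {1, -1}. P q)"
      using b(1) x by (auto simp: P_def)
  qed
  have patch: "emeasure (hausdorff_measure k) (P q) < \<infinity>" if q: "q \<in> B \<times> {1, -1}" for q
  proof -
    obtain b s where bs: "q = (b, s)" "b \<in> B" "s = 1 \<or> s = -1" using q by auto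
    let ?I = "B - {b}"
    have lip: "dist x y \<le> (2 * m + 1) * (\<Sum>i\<in>?I. \<bar>x \<bullet> i - y \<bullet> i\<bar>)"
      if "x \<in> P q" "y \<in> P q" for x y
    proof -
      have xy: "x \<in> V \<inter> sphere 0 1" "y \<in> V \<inter> sphere 0 1"
          "1 / m \<le> s * (x \<bullet> b)" "1 / m \<le> s * (y \<bullet> b)"
        using that by (auto simp: P_def bs)
      let ?S = "\<Sum>i\<in>?I. \<bar>x \<bullet> i - y \<bullet> i\<bar>"
      have "\<bar>(x \<bullet> b)\<^sup>2 - (y \<bullet> b)\<^sup>2\<bar> = \<bar>\<Sum>i\<in>?I. (y \<bullet> i)\<^sup>2 - (x \<bullet> i)\<^sup>2\<bar>"
        using sq[OF xy(1)] sq[OF xy(2)]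
        by (simp add: sum.remove[OF finB bs(2)] sum_subtractf)
      also have "\<dots> \<le> (\<Sum>i\<in>?I. \<bar>(y \<bullet> i)\<^sup>2 - (x \<bullet> i)\<^sup>2\<bar>)" by (rule sum_abs)
      also have "\<dots> \<le> (\<Sum>i\<in>?I. 2 * \<bar>x \<bullet> i - y \<bullet> i\<bar>)"
      proof (rule sum_mono)
        fix i assume "i \<in> ?I"
        then have "\<bar>y \<bullet> i + x \<bullet> i\<bar> \<le> 2" using le1[of x i] le1[of y i] xy by auto
        then show "\<bar>(y \<bullet> i)\<^sup>2 - (x \<bullet> i)\<^sup>2\<bar> \<le> 2 * \<bar>x \<bullet> i - y \<bullet> i\<bar>"
          using mult_right_mono[of "\<bar>y \<bullet> i + x \<bullet> i\<bar>" 2 "\<bar>x \<bullet> i - y \<bullet> i\<bar>"]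
          by (simp add: power2_eq_square square_diff_square_factored abs_mult abs_minus_commute)
      qed
      finally have 1: "\<bar>(x \<bullet> b)\<^sup>2 - (y \<bullet> b)\<^sup>2\<bar> \<le> 2 * ?S" by (simp add: sum_distrib_left)
      have "1 / m \<le> \<bar>x \<bullet> b + y \<bullet> b\<bar>"
      proof -
        have "0 < 1 / m" using m by simp
        then show ?thesis using xy(3,4) bs(3) by (elim disjE; simp only:; linarith)
      qed
      then have "\<bar>x \<bullet> b - y \<bullet> b\<bar> * (1 / m) \<le> \<bar>x \<bullet> b - y \<bullet> b\<bar> * \<bar>x \<bullet> b + y \<bullet> b\<bar>"
        by (rule mult_left_mono) simp
      also have "\<dots> = \<bar>(x \<bullet> b)\<^sup>2 - (y \<bullet> b)\<^sup>2\<bar>"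
        by (simp add: power2_eq_square square_diff_square_factored abs_mult mult.commute)
      finally have 3: "\<bar>x \<bullet> b - y \<bullet> b\<bar> * (1 / m) \<le> \<bar>(x \<bullet> b)\<^sup>2 - (y \<bullet> b)\<^sup>2\<bar>" .
      have 2: "\<bar>x \<bullet> b - y \<bullet> b\<bar> \<le> 2 * m * ?S"
      proof -
        have "\<bar>x \<bullet> b - y \<bullet> b\<bar> \<le> m * \<bar>(x \<bullet> b)\<^sup>2 - (y \<bullet> b)\<^sup>2\<bar>"
          using 3 m by (simp add: field_simps)
        also have "\<dots> \<le> m * (2 * ?S)" using 1 m by (intro mult_left_mono) auto
        finally show ?thesis by simp
      qed
      have "x - y \<in> V" using xy V by (auto intro: subspace_diff)
      then have "dist x y = norm (\<Sum>i\<in>B. ((x - y) \<bullet> i) *\<^sub>R i)"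
        using expand by (simp add: dist_norm)
      also have "\<dots> \<le> (\<Sum>i\<in>B. \<bar>x \<bullet> i - y \<bullet> i\<bar>)"
        by (rule sum_norm_le) (simp add: B(3) inner_diff_left)
      also have "\<dots> = \<bar>x \<bullet> b - y \<bullet> b\<bar> + ?S" by (rule sum.remove[OF finB bs(2)])
      also have "\<dots> \<le> (2 * m + 1) * ?S" using 2 by (simp add: algebra_simps)
      finally show ?thesis .
    qed
    have "hausdorff_outer_measure (card ?I) (P q) < \<infinity>"
    proof (rule hausdorff_outer_measure_finite_if_coordinates[where L = "2 * m + 1"])
      show "finite ?I" using finB by simp
      show "\<bar>x \<bullet> i\<bar> \<le> 1" if "i \<in> ?I" "x \<in> P q" for i x
        using that le1 by (auto simp: P_def bs)
    qed (use lip m in auto)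
    moreover have "card ?I = k" using B(5) bs(2) finB by simp
    ultimately show ?thesis
      using emeasure_hausdorff_measure_le le_less_trans by metis
  qed
  have "closed (P q)" for q
  proof -
    have "P q = (V \<inter> sphere 0 1) \<inter> {x. 1 / m \<le> snd q * (x \<bullet> fst q)}"
      by (auto simp: P_def split: prod.splits)
    then show ?thesis
      using closed_subspace[OF V]
      by (auto intro!: closed_Int closed_Collect_le continuous_intros)
  qed
  then have sets: "P ` (B \<times> {1, -1}) \<subseteq> sets (hausdorff_measure k)" by auto
  have "emeasure (hausdorff_measure k) (V \<inter> sphere 0 1)
      \<le> emeasure (hausdorff_measure k) (\<Union>q\<in>B \<times> {1, -1}. P q)"
    using sets finB by (intro emeasure_mono[OF cover] sets.finite_UN) auto
  also have "\<dots> \<le> (\<Sum>q\<in>B \<times> {1, -1}. emeasure (hausdorff_measure k) (P q))"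
    using sets finB by (intro emeasure_subadditive_finite) auto
  also have "\<dots> < \<infinity>"
    using patch finB by (simp add: less_top[symmetric])
  finally show ?thesis .
qed

section \<open>Smooth functions on compact sets\<close>

lemma C_k_on_imp_locally_lipschitz:
  fixes F :: "'a::euclidean_space \<Rightarrow> 'b::real_normed_vector"
  assumes F: "C_k_on (Suc 0) F U" and U: "open U" and x: "x \<in> U"
  shows "\<exists>u>0. \<exists>L. cball x u \<subseteq> U \<and> L-lipschitz_on (cball x u) F"
proof -
  obtain u where u: "u > 0" "cball x u \<subseteq> U" using U x open_contains_cball by blast
  let ?D = "\<lambda>y. frechet_derivative F (at y)"
  have D: "(F has_derivative ?D y) (at y)" if "y \<in> U" for y
    using F U that by (auto simp: differentiable_on_eq_differentiable_at frechet_derivative_works[symmetric])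
  have "\<exists>K. \<forall>y\<in>cball x u. norm (?D y v) \<le> K" for v
  proof -
    have "continuous_on (cball x u) (\<lambda>y. ?D y v)"
      using F u(2) by (auto intro: continuous_on_subset)
    then have "bounded ((\<lambda>y. ?D y v) ` cball x u)"
      by (intro compact_imp_bounded compact_continuous_image) auto
    then show ?thesis by (auto simp: bounded_iff)
  qed
  then obtain K where K: "\<And>v y. y \<in> cball x u \<Longrightarrow> norm (?D y v) \<le> K v" by metis
  have "(max 0 (\<Sum>v\<in>Basis. K v))-lipschitz_on (cball x u) F"
  proof (rule lipschitz_onI)
    fix y z assume yz: "y \<in> cball x u" "z \<in> cball x u"
    have "norm (F y - F z) \<le> max 0 (\<Sum>v\<in>Basis. K v) * norm (y - z)"
    proof (rule differentiable_bound[of "cball x u" F ?D])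
      show "(F has_derivative ?D w) (at w within cball x u)" if "w \<in> cball x u" for w
        using D u(2) that has_derivative_at_withinI by blast
      show "onorm (?D w) \<le> max 0 (\<Sum>v\<in>Basis. K v)" if "w \<in> cball x u" for w
      proof -
        have "onorm (?D w) \<le> (\<Sum>v\<in>Basis. norm (?D w v))"
          using D u(2) that has_derivative_bounded_linear by (intro onorm_componentwise) blast
        also have "\<dots> \<le> (\<Sum>v\<in>Basis. K v)" using K[OF that] by (intro sum_mono)
        finally show ?thesis by simp
      qed
    qed (use yz in auto)
    then show "dist (F y) (F z) \<le> max 0 (\<Sum>v\<in>Basis. K v) * dist y z"
      by (simp add: dist_norm)
  qed simp
  then show ?thesis using u by blast
qed

lemma smooth_onE:
  assumes "smooth_on S f" "x \<in> S"
  obtains U F where "open U" "x \<in> U" "\<And>k. C_k_on k F U" "\<And>y. y \<in> S \<inter> U \<Longrightarrow> F y = f y"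
proof -
  obtain U F where UF: "open U \<and> x \<in> U \<and> (\<forall>k. C_k_on k F U) \<and> (\<forall>y\<in>S \<inter> U. F y = f y)"
    using bspec[OF assms(1)[unfolded smooth_on_def] assms(2)] by (elim exE)
  show thesis by (rule that[of U F]) (simp_all add: UF)
qed

lemma smooth_on_compact_imp_lipschitz:
  fixes f :: "'a::euclidean_space \<Rightarrow> 'b::real_normed_vector"
  assumes f: "smooth_on S f" and S: "compact S"
  obtains L where "L-lipschitz_on S f"
proof -
  have "local_lipschitz {0::real} S (\<lambda>_. f)"
  proof (rule local_lipschitzI)
    fix t :: real and x assume x: "x \<in> S"
    obtain U F where U: "open U" "x \<in> U" "\<And>k. C_k_on k F U" "\<And>y. y \<in> S \<inter> U \<Longrightarrow> F y = f y"
      using smooth_onE[OF f x] by metis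
    obtain u L where u: "u > 0" "cball x u \<subseteq> U" "L-lipschitz_on (cball x u) F"
      using C_k_on_imp_locally_lipschitz[OF U(3,1,2)] by blast
    have "L-lipschitz_on (cball x u \<inter> S) F"
      using u(3) by (rule lipschitz_on_subset) blast
    then have "L-lipschitz_on (cball x u \<inter> S) f"
      by (rule lipschitz_on_transform) (use U(4) u(2) in auto)
    then show "\<exists>u>0. \<exists>L. \<forall>t\<in>cball t u \<inter> {0}. L-lipschitz_on (cball x u \<inter> S) f"
      using u(1) by blast
  qed
  then obtain L where "L-lipschitz_on S f"
    using local_lipschitz_compact_implies_lipschitz[OF _ S, of "{0::real}" "\<lambda>_. f"] by auto
  then show ?thesis by (rule that)
qed

text \<open>
  The derivative at \<open>x\<close> along a curve inside \<open>S\<close> depends on the velocity of the curve only. This is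
  what lets the two different parametrizations of a great circle be compared.
\<close>

lemma smooth_on_has_curve_derivative:
  fixes f :: "'a::euclidean_space \<Rightarrow> 'b::real_normed_vector"
  assumes f: "smooth_on S f" and x: "x \<in> S"
  obtains D where
    "\<And>\<gamma> v (r::real). \<gamma> 0 = x \<Longrightarrow> (\<gamma> has_vector_derivative v) (at 0) \<Longrightarrow> 0 < r \<Longrightarrow>
       (\<And>t. \<bar>t\<bar> < r \<Longrightarrow> \<gamma> t \<in> S) \<Longrightarrow> ((\<lambda>t. f (\<gamma> t)) has_vector_derivative D v) (at 0)"
proof -
  obtain U F where U: "open U" "x \<in> U" "\<And>k. C_k_on k F U" "\<And>y. y \<in> S \<inter> U \<Longrightarrow> F y = f y"
    using smooth_onE[OF f x] by metis
  let ?D = "frechet_derivative F (at x)"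
  have D: "(F has_derivative ?D) (at x)"
    using U(3)[of "Suc 0"] U(1,2)
    by (auto simp: differentiable_on_eq_differentiable_at frechet_derivative_works[symmetric])
  show thesis
  proof
    fix \<gamma> :: "real \<Rightarrow> 'a" and v r
    assume \<gamma>: "\<gamma> 0 = x" "(\<gamma> has_vector_derivative v) (at 0)" "0 < r" "\<And>t. \<bar>t\<bar> < r \<Longrightarrow> \<gamma> t \<in> S"
    have F\<gamma>: "((\<lambda>t. F (\<gamma> t)) has_vector_derivative ?D v) (at 0)"
      using vector_derivative_diff_chain_within[OF \<gamma>(2), of F ?D]
        has_derivative_at_withinI[OF D] \<gamma>(1) by (simp add: o_def)
    have "isCont \<gamma> 0" using has_vector_derivative_continuous[OF \<gamma>(2)] .
    then have "eventually (\<lambda>t. \<gamma> t \<in> U) (nhds 0)"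
      using U(1,2) \<gamma>(1) by (metis isCont_def tendsto_at_iff_tendsto_nhds topological_tendstoD)
    then obtain e where e: "e > 0" "\<And>t. \<bar>t\<bar> < e \<Longrightarrow> \<gamma> t \<in> U"
      by (auto simp: eventually_nhds_metric dist_real_def)
    show "((\<lambda>t. f (\<gamma> t)) has_vector_derivative ?D v) (at 0)"
      by (rule has_vector_derivative_transform_within[OF F\<gamma>, of "min e r"])
        (use e \<gamma>(3,4) U(4) in \<open>auto simp: dist_real_def\<close>)
  qed
qed

section \<open>Differentiation under the integral\<close>

lemma has_vector_derivative_at_0_iff_diff_quotient:
  "(g has_vector_derivative D) (at (0::real)) \<longleftrightarrow>
     ((\<lambda>t. (g t - g 0) /\<^sub>R t) \<longlongrightarrow> D) (at 0)"
proof -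
  have "(g has_vector_derivative D) (at 0) \<longleftrightarrow>
      ((\<lambda>t. norm (g t - g 0 - t *\<^sub>R D) / norm t) \<longlongrightarrow> 0) (at 0)"
    by (simp add: has_vector_derivative_def has_derivative_iff_norm bounded_linear_scaleR_left)
  also have "\<dots> \<longleftrightarrow> ((\<lambda>t. norm ((g t - g 0) /\<^sub>R t - D)) \<longlongrightarrow> 0) (at 0)"
  proof (rule tendsto_cong)
    show "\<forall>\<^sub>F t in at 0. norm (g t - g 0 - t *\<^sub>R D) / norm t = norm ((g t - g 0) /\<^sub>R t - D)"
      unfolding eventually_at
    proof (intro exI[of _ 1] conjI ballI impI)
      fix t :: real assume "t \<noteq> 0 \<and> dist t 0 < 1"
      then have "(g t - g 0) /\<^sub>R t - D = (g t - g 0 - t *\<^sub>R D) /\<^sub>R t"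
        by (simp add: scaleR_diff_right)
      then show "norm (g t - g 0 - t *\<^sub>R D) / norm t = norm ((g t - g 0) /\<^sub>R t - D)"
        by (simp add: divide_inverse mult.commute)
    qed simp
  qed
  also have "\<dots> \<longleftrightarrow> ((\<lambda>t. (g t - g 0) /\<^sub>R t) \<longlongrightarrow> D) (at 0)"
    using Lim_null[of "\<lambda>t. (g t - g 0) /\<^sub>R t" D] by (simp add: tendsto_norm_zero_iff)
  finally show ?thesis .
qed

lemma has_vector_derivative_set_integral:
  fixes g :: "real \<Rightarrow> 'a \<Rightarrow> 'b::{banach, second_countable_topology}"
  assumes A: "A \<in> sets M" "emeasure M A < \<infinity>" and r: "0 < r"
    and int: "\<And>t. \<bar>t\<bar> < r \<Longrightarrow> set_integrable M A (g t)"
    and lip: "\<And>t x. \<bar>t\<bar> < r \<Longrightarrow> x \<in> A \<Longrightarrow> norm (g t x - g 0 x) \<le> L * \<bar>t\<bar>"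
    and der: "\<And>x. x \<in> A \<Longrightarrow> ((\<lambda>t. g t x) has_vector_derivative g' x) (at 0)"
  shows "((\<lambda>t. LINT x:A|M. g t x) has_vector_derivative (LINT x:A|M. g' x)) (at 0)"
  unfolding has_vector_derivative_at_0_iff_diff_quotient tendsto_at_iff_sequentially
proof (intro allI impI)
  fix X :: "nat \<Rightarrow> real" assume X0: "\<forall>i. X i \<in> UNIV - {0}" and X: "X \<longlonglongrightarrow> 0"
  let ?q = "\<lambda>t x. (g t x - g 0 x) /\<^sub>R t"
  \<comment> \<open>The domination holds only for parameters below \<open>r\<close>, so a tail of the sequence is used.\<close>
  have "\<forall>\<^sub>F i in sequentially. \<bar>X i\<bar> < r"
    using X r by (auto simp: tendsto_iff dist_real_def)
  then obtain N where "\<forall>n\<ge>N. \<bar>X n\<bar> < r"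
    unfolding eventually_sequentially by blast
  then have N: "\<bar>X (i + N)\<bar> < r" for i by simp
  have q: "(LINT x:A|M. ?q t x) = ((LINT x:A|M. g t x) - (LINT x:A|M. g 0 x)) /\<^sub>R t"
      "set_integrable M A (?q t)" if "\<bar>t\<bar> < r" for t
  proof -
    have "set_integrable M A (g t)" "set_integrable M A (g 0)"
      using int that r by simp_all
    note diff = set_integral_diff[OF this]
    show "(LINT x:A|M. ?q t x) = ((LINT x:A|M. g t x) - (LINT x:A|M. g 0 x)) /\<^sub>R t"
      unfolding set_integral_scaleR_right diff(2) ..
    show "set_integrable M A (?q t)"
      by (rule set_integrable_scaleR_right) (rule diff(1))
  qed
  have lim: "(\<lambda>i. indicator A x *\<^sub>R ?q (X (i + N)) x) \<longlonglongrightarrow> indicator A x *\<^sub>R g' x" for x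
  proof (cases "x \<in> A")
    case True
    then have "(\<lambda>i. ?q (X i) x) \<longlonglongrightarrow> g' x"
      using der[OF True] X0 X
      unfolding has_vector_derivative_at_0_iff_diff_quotient tendsto_at_iff_sequentially
      by (auto simp: o_def)
    then show ?thesis using True LIMSEQ_ignore_initial_segment by fastforce
  qed simp
  have meas: "(\<lambda>x. indicator A x *\<^sub>R ?q (X (i + N)) x) \<in> borel_measurable M" for i
    using q(2)[OF N[of i]] by (auto simp: set_integrable_def)
  have "(\<lambda>i. LINT x:A|M. ?q (X (i + N)) x) \<longlonglongrightarrow> (LINT x:A|M. g' x)"
    unfolding set_lebesgue_integral_def
  proof (rule integral_dominated_convergence[where w = "\<lambda>x. indicator A x * \<bar>L\<bar>"])
    show "(\<lambda>x. indicator A x *\<^sub>R g' x) \<in> borel_measurable M"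
      using meas lim by (rule borel_measurable_LIMSEQ_metric)
    show "integrable M (\<lambda>x. indicator A x * \<bar>L\<bar>)"
      using A by simp
    show "AE x in M. norm (indicator A x *\<^sub>R ?q (X (i + N)) x) \<le> indicator A x * \<bar>L\<bar>" for i
    proof (intro always_eventually allI)
      fix x
      have "norm (?q (X (i + N)) x) \<le> \<bar>L\<bar>" if "x \<in> A"
      proof -
        have "X (i + N) \<noteq> 0" using X0 by simp
        moreover have "norm (g (X (i + N)) x - g 0 x) \<le> \<bar>L\<bar> * \<bar>X (i + N)\<bar>"
          by (rule order_trans[OF lip[OF N that]]) (simp add: mult_right_mono)
        ultimately show ?thesis unfolding norm_scaleR by (simp add: field_simps)
      qed
      then show "norm (indicator A x *\<^sub>R ?q (X (i + N)) x) \<le> indicator A x * \<bar>L\<bar>"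
        by (auto simp: indicator_def)
    qed
  qed (use lim meas in auto)
  then have "(\<lambda>i. ((LINT x:A|M. g (X (i + N)) x) - (LINT x:A|M. g 0 x)) /\<^sub>R X (i + N))
      \<longlonglongrightarrow> (LINT x:A|M. g' x)"
    unfolding q(1)[OF N] .
  then show "((\<lambda>t. ((LINT x:A|M. g t x) - (LINT x:A|M. g 0 x)) /\<^sub>R t) \<circ> X)
      \<longlonglongrightarrow> (LINT x:A|M. g' x)"
    unfolding o_def by (rule LIMSEQ_offset)
qed

section \<open>The slices of the sphere\<close>

lemma closed_sphere_slice: "closed (sphere_slice \<xi> t)"
proof -
  have "sphere_slice \<xi> t = sphere 0 1 \<inter> {\<eta>. \<xi> \<bullet> \<eta> = t}"
    by (auto simp: sphere_slice_def)
  then show ?thesis by (auto intro!: closed_Int closed_hyperplane)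
qed

lemma sphere_slice_borel [simp]: "sphere_slice \<xi> t \<in> sets borel"
  by (rule borel_closed[OF closed_sphere_slice])

lemma compact_sphere_slice: "compact (sphere_slice \<xi> t)"
  using compact_Int_closed[OF compact_sphere[of 0 1] closed_sphere_slice[of \<xi> t]]
  by (simp add: sphere_slice_def Int_def conj_commute cong: conj_cong)

lemma sphere_slice_affine_iff:
  assumes \<xi>: "norm \<xi> = 1" and t: "\<bar>t\<bar> < 1"
  shows "t *\<^sub>R \<xi> + sqrt (1 - t\<^sup>2) *\<^sub>R \<omega> \<in> sphere_slice \<xi> t \<longleftrightarrow> \<omega> \<in> sphere_slice \<xi> 0"
proof -
  have t2: "1 - t\<^sup>2 > 0" using t by (simp add: abs_square_less_1)
  have "norm (t *\<^sub>R \<xi> + sqrt (1 - t\<^sup>2) *\<^sub>R \<omega>) = 1 \<longleftrightarrow> norm \<omega> = 1" if "\<xi> \<bullet> \<omega> = 0"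
  proof -
    have "(norm (t *\<^sub>R \<xi> + sqrt (1 - t\<^sup>2) *\<^sub>R \<omega>))\<^sup>2 = t\<^sup>2 + (1 - t\<^sup>2) * (norm \<omega>)\<^sup>2"
      using that \<xi> t2 by (subst norm_add_Pythagorean) (auto simp: orthogonal_def power_mult_distrib)
    then have "(norm (t *\<^sub>R \<xi> + sqrt (1 - t\<^sup>2) *\<^sub>R \<omega>))\<^sup>2 - 1 = (1 - t\<^sup>2) * ((norm \<omega>)\<^sup>2 - 1)"
      by (simp add: algebra_simps)
    then have "(norm (t *\<^sub>R \<xi> + sqrt (1 - t\<^sup>2) *\<^sub>R \<omega>))\<^sup>2 = 1 \<longleftrightarrow> (1 - t\<^sup>2) * ((norm \<omega>)\<^sup>2 - 1) = 0"
      by (metis right_minus_eq)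
    also have "\<dots> \<longleftrightarrow> (norm \<omega>)\<^sup>2 = 1" using t2 by simp
    finally show ?thesis by (simp add: abs_square_eq_1)
  qed
  moreover have "\<xi> \<bullet> (t *\<^sub>R \<xi> + sqrt (1 - t\<^sup>2) *\<^sub>R \<omega>) = t \<longleftrightarrow> \<xi> \<bullet> \<omega> = 0"
    using \<xi> t2 by (simp add: inner_add_right dot_square_norm)
  ultimately show ?thesis by (auto simp: sphere_slice_def)
qed

lemma emeasure_sphere_slice_finite:
  fixes \<xi> :: "real ^ 'n"
  assumes "CARD('n) \<ge> 2" "norm \<xi> = 1"
  shows "emeasure (hausdorff_measure (CARD('n) - 2)) (sphere_slice \<xi> 0) < \<infinity>"
proof -
  have "\<xi> \<noteq> 0" using assms(2) by auto
  have "sphere_slice \<xi> 0 = {x. \<xi> \<bullet> x = 0} \<inter> sphere 0 1"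
    by (auto simp: sphere_slice_def)
  then show ?thesis
    using emeasure_hausdorff_measure_unit_sphere_finite[OF subspace_hyperplane[of \<xi>], of "CARD('n) - 2"]
      dim_hyperplane[OF \<open>\<xi> \<noteq> 0\<close>] assms(1) by simp
qed

text \<open>
  The similarity \<open>\<omega> \<mapsto> t *\<^sub>R \<xi> + sqrt (1 - t\<^sup>2) *\<^sub>R \<omega>\<close> carries the equator onto the slice at height
  \<open>t\<close>, so all slice integrals become integrals over the equator.
\<close>

lemma set_integral_sphere_slice:
  fixes f :: "real ^ 'n \<Rightarrow> 'b::{banach, second_countable_topology}"
  assumes \<xi>: "norm \<xi> = 1" and t: "\<bar>t\<bar> < 1" and f: "continuous_on (sphere 0 1) f"
  shows "(LINT \<eta>:sphere_slice \<xi> t|hausdorff_measure k. f \<eta>) =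
    sqrt (1 - t\<^sup>2) ^ k *\<^sub>R
      (LINT \<omega>:sphere_slice \<xi> 0|hausdorff_measure k. f (t *\<^sub>R \<xi> + sqrt (1 - t\<^sup>2) *\<^sub>R \<omega>))"
proof -
  have t2: "sqrt (1 - t\<^sup>2) > 0" using t by (simp add: abs_square_less_1)
  have "(\<lambda>\<eta>. indicator (sphere_slice \<xi> t) \<eta> *\<^sub>R f \<eta>) \<in> borel_measurable borel"
    using f by (intro borel_measurable_continuous_on_indicator)
      (auto simp: sphere_slice_def closed_sphere_slice intro: continuous_on_subset)
  from integral_hausdorff_measure_affine[OF t2 this, of k "t *\<^sub>R \<xi>"]
  show ?thesis
    unfolding set_lebesgue_integral_def
    by (simp add: indicator_def sphere_slice_affine_iff[OF \<xi> t])
qed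

section \<open>Comparison of the two transforms\<close>

lemma generalized_funk_radon_0: "generalized_funk_radon 0 f \<xi> = integro_differential 0 f \<xi>"
  by (simp add: generalized_funk_radon_def integro_differential_def integro_differential_at_def
      nth_vector_derivative_def)

text \<open>
  For \<open>\<omega>\<close> on the equator, \<open>t \<mapsto> t *\<^sub>R \<xi> + sqrt (1 - t\<^sup>2) *\<^sub>R \<omega>\<close> and
  \<open>\<tau> \<mapsto> sin \<tau> *\<^sub>R \<xi> + cos \<tau> *\<^sub>R \<omega>\<close> run on the sphere and leave \<open>\<omega>\<close> with the same velocity \<open>\<xi>\<close>.
\<close>

lemma slice_integral_has_vector_derivative:
  fixes f :: "real ^ 'n \<Rightarrow> 'b::{banach, second_countable_topology}"
  assumes n: "CARD('n) \<ge> 2" and f: "smooth_on (sphere 0 1) f" and \<xi>: "norm \<xi> = 1"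
  shows "((\<lambda>t. LINT \<omega>:sphere_slice \<xi> 0|hausdorff_measure (CARD('n) - 2).
              f (t *\<^sub>R \<xi> + sqrt (1 - t\<^sup>2) *\<^sub>R \<omega>))
          has_vector_derivative integro_differential 1 f \<xi>) (at 0)"
proof -
  let ?M = "hausdorff_measure (CARD('n) - 2) :: (real ^ 'n) measure"
  let ?\<gamma> = "\<lambda>\<omega> t. t *\<^sub>R \<xi> + sqrt (1 - t\<^sup>2) *\<^sub>R \<omega>"
  let ?\<rho> = "\<lambda>\<omega> \<tau>. sin \<tau> *\<^sub>R \<xi> + cos \<tau> *\<^sub>R \<omega>"
  obtain L where L: "L-lipschitz_on (sphere 0 1) f"
    using smooth_on_compact_imp_lipschitz[OF f compact_sphere] by blast
  have contf: "continuous_on (sphere 0 1) f" using L by (rule lipschitz_on_continuous_on)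
  have \<gamma>: "?\<gamma> \<omega> t \<in> sphere 0 1" if "\<omega> \<in> sphere_slice \<xi> 0" "\<bar>t\<bar> < 1" for \<omega> t
    using sphere_slice_affine_iff[OF \<xi> that(2), of \<omega>] that(1) by (simp add: sphere_slice_def)
  have \<rho>: "?\<rho> \<omega> \<tau> \<in> sphere 0 1" if "\<omega> \<in> sphere_slice \<xi> 0" for \<omega> \<tau>
  proof -
    have "(norm (?\<rho> \<omega> \<tau>))\<^sup>2 = (sin \<tau>)\<^sup>2 + (cos \<tau>)\<^sup>2"
      using that \<xi> by (subst norm_add_Pythagorean) (auto simp: orthogonal_def sphere_slice_def)
    then have "(norm (?\<rho> \<omega> \<tau>))\<^sup>2 = 1\<^sup>2" by simp
    then have "norm (?\<rho> \<omega> \<tau>) = 1" by (rule power2_eq_imp_eq) auto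
    then show ?thesis by simp
  qed
  have \<gamma>': "(?\<gamma> \<omega> has_vector_derivative \<xi>) (at 0)" for \<omega>
    by (auto intro!: derivative_eq_intros)
  have \<rho>': "(?\<rho> \<omega> has_vector_derivative \<xi>) (at 0)" for \<omega>
    by (auto intro!: derivative_eq_intros)
  have der: "((\<lambda>t. f (?\<gamma> \<omega> t)) has_vector_derivative
      nth_vector_derivative 1 (\<lambda>\<tau>. f (?\<rho> \<omega> \<tau>)) 0) (at 0)" if \<omega>: "\<omega> \<in> sphere_slice \<xi> 0" for \<omega>
  proof -
    have \<omega>1: "\<omega> \<in> sphere 0 1" using \<omega> by (simp add: sphere_slice_def)
    obtain D where
      D: "\<And>\<gamma> v (r::real). \<gamma> 0 = \<omega> \<Longrightarrow> (\<gamma> has_vector_derivative v) (at 0) \<Longrightarrow> 0 < r \<Longrightarrow>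
       (\<And>t. \<bar>t\<bar> < r \<Longrightarrow> \<gamma> t \<in> sphere 0 1) \<Longrightarrow> ((\<lambda>t. f (\<gamma> t)) has_vector_derivative D v) (at 0)"
      by (fact smooth_on_has_curve_derivative[OF f \<omega>1])
    have "((\<lambda>t. f (?\<gamma> \<omega> t)) has_vector_derivative D \<xi>) (at 0)"
      by (rule D[OF _ \<gamma>', of _ 1]) (use \<gamma>[OF \<omega>] in auto)
    moreover have "((\<lambda>\<tau>. f (?\<rho> \<omega> \<tau>)) has_vector_derivative D \<xi>) (at 0)"
      by (rule D[OF _ \<rho>', of _ 1]) (use \<rho>[OF \<omega>] in auto)
    ultimately show ?thesis
      by (simp add: nth_vector_derivative_def vector_derivative_at)
  qed
  have lip: "norm (f (?\<gamma> \<omega> t) - f (?\<gamma> \<omega> 0)) \<le> (2 * L) * \<bar>t\<bar>"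
    if t: "\<bar>t\<bar> < 1" and \<omega>: "\<omega> \<in> sphere_slice \<xi> 0" for t \<omega>
  proof -
    have "t\<^sup>2 = \<bar>t\<bar> * \<bar>t\<bar>" by (simp add: power2_eq_square)
    also have "\<dots> \<le> \<bar>t\<bar> * 1" using t by (intro mult_left_mono) simp_all
    finally have t2: "t\<^sup>2 \<le> \<bar>t\<bar>" by simp
    define u where "u = 1 - t\<^sup>2"
    have u: "0 \<le> u" "u \<le> 1" using t t2 by (simp_all add: u_def)
    then have "u\<^sup>2 \<le> u" using mult_left_mono[of u 1 u] by (simp add: power2_eq_square)
    then have "1 - t\<^sup>2 \<le> sqrt (1 - t\<^sup>2)" "sqrt (1 - t\<^sup>2) \<le> 1"
      using u real_le_rsqrt[of u u] by (simp_all flip: u_def)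
    then have s: "\<bar>sqrt (1 - t\<^sup>2) - 1\<bar> \<le> \<bar>t\<bar>" using t2 by linarith
    have "norm (?\<gamma> \<omega> t - ?\<gamma> \<omega> 0) = norm (t *\<^sub>R \<xi> + (sqrt (1 - t\<^sup>2) - 1) *\<^sub>R \<omega>)"
      by (simp add: algebra_simps)
    also have "\<dots> \<le> \<bar>t\<bar> + \<bar>sqrt (1 - t\<^sup>2) - 1\<bar>"
      using \<omega> \<xi> by (intro norm_triangle_le) (simp add: sphere_slice_def)
    also have "\<dots> \<le> 2 * \<bar>t\<bar>" using s by simp
    finally have "L * norm (?\<gamma> \<omega> t - ?\<gamma> \<omega> 0) \<le> L * (2 * \<bar>t\<bar>)"
      using lipschitz_on_nonneg[OF L] by (rule mult_left_mono)
    moreover have "norm (f (?\<gamma> \<omega> t) - f (?\<gamma> \<omega> 0)) \<le> L * norm (?\<gamma> \<omega> t - ?\<gamma> \<omega> 0)"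
      using lipschitz_onD[OF L \<gamma>[OF \<omega> t] \<gamma>[OF \<omega>, of 0]] by (simp add: dist_norm)
    ultimately show ?thesis by simp
  qed
  have fin: "emeasure ?M (sphere_slice \<xi> 0) < \<infinity>"
    using emeasure_sphere_slice_finite[OF n \<xi>] .
  have int: "set_integrable ?M (sphere_slice \<xi> 0) (\<lambda>\<omega>. f (?\<gamma> \<omega> t))" if t: "\<bar>t\<bar> < 1" for t
  proof -
    have cont: "continuous_on (sphere_slice \<xi> 0) (\<lambda>\<omega>. f (?\<gamma> \<omega> t))"
      by (rule continuous_on_compose2[OF contf]) (use \<gamma> t in \<open>auto intro!: continuous_intros\<close>)
    then have "bounded ((\<lambda>\<omega>. f (?\<gamma> \<omega> t)) ` sphere_slice \<xi> 0)"
      using compact_sphere_slice by (intro compact_imp_bounded compact_continuous_image)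
    then obtain C where C: "\<And>\<omega>. \<omega> \<in> sphere_slice \<xi> 0 \<Longrightarrow> norm (f (?\<gamma> \<omega> t)) \<le> C"
      by (auto simp: bounded_iff)
    have "(\<lambda>\<omega>. indicator (sphere_slice \<xi> 0) \<omega> *\<^sub>R f (?\<gamma> \<omega> t)) \<in> borel_measurable borel"
      using cont by (intro borel_measurable_continuous_on_indicator) auto
    then show ?thesis
      unfolding set_integrable_def using fin C
      by (intro integrableI_bounded_set[where A = "sphere_slice \<xi> 0" and B = C]) auto
  qed
  have "((\<lambda>t. LINT \<omega>:sphere_slice \<xi> 0|?M. f (?\<gamma> \<omega> t)) has_vector_derivative
      (LINT \<omega>:sphere_slice \<xi> 0|?M. nth_vector_derivative 1 (\<lambda>\<tau>. f (?\<rho> \<omega> \<tau>)) 0)) (at 0)"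
    using int lip der fin
    by (intro has_vector_derivative_set_integral[where r = 1 and L = "2 * L"]) auto
  then show ?thesis
    by (simp only: integro_differential_def integro_differential_at_def)
qed

lemma generalized_funk_radon_1:
  fixes f :: "real ^ 'n \<Rightarrow> 'b::{banach, second_countable_topology}"
  assumes n: "CARD('n) \<ge> 2" and f: "smooth_on (sphere 0 1) f" and \<xi>: "norm \<xi> = 1"
  shows "generalized_funk_radon 1 f \<xi> = - integro_differential 1 f \<xi>"
proof -
  let ?k = "CARD('n) - 2"
  let ?G = "\<lambda>t. LINT \<omega>:sphere_slice \<xi> 0|hausdorff_measure ?k. f (t *\<^sub>R \<xi> + sqrt (1 - t\<^sup>2) *\<^sub>R \<omega>)"
  let ?c = "\<lambda>t::real. (1 - t\<^sup>2) powr (-1/2) * sqrt (1 - t\<^sup>2) ^ ?k"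
  have contf: "continuous_on (sphere 0 1) f"
    using smooth_on_compact_imp_lipschitz[OF f compact_sphere] lipschitz_on_continuous_on by blast
  \<comment> \<open>The factor is even in \<open>t\<close> with value 1 at 0, so the product rule leaves only the derivative
    of the integral.\<close>
  have "(?c has_real_derivative 0) (at 0)"
    by (auto intro!: derivative_eq_intros)
  then have "((\<lambda>t. ?c t *\<^sub>R ?G t) has_vector_derivative integro_differential 1 f \<xi>) (at 0)"
    using has_vector_derivative_scaleR[OF _ slice_integral_has_vector_derivative[OF n f \<xi>], of ?c 0]
    by simp
  then have "((\<lambda>t. (1 - t\<^sup>2) powr (-1/2) *\<^sub>R
        (LINT \<eta>:sphere_slice \<xi> t|hausdorff_measure ?k. f \<eta>))
      has_vector_derivative integro_differential 1 f \<xi>) (at 0)"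
    by (rule has_vector_derivative_transform_within[of _ _ _ _ 1])
      (auto simp: set_integral_sphere_slice[OF \<xi> _ contf] dist_real_def)
  then show ?thesis
    by (simp add: generalized_funk_radon_def nth_vector_derivative_def vector_derivative_at)
qed

theorem theorem3p6:
  fixes f :: "real ^ 'n \<Rightarrow> 'b::{real_normed_field, euclidean_space}"
  assumes "CARD('n) \<ge> 3"
    and "smooth_on (sphere 0 1) f"
    and "\<xi> \<in> sphere (0 :: real ^ 'n) 1"
  shows "generalized_funk_radon 0 f \<xi> = integro_differential 0 f \<xi> \<and>
         generalized_funk_radon 1 f \<xi> = - integro_differential 1 f \<xi>"
  using assms generalized_funk_radon_0 generalized_funk_radon_1[of f \<xi>] by simp

unused_thms

end
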